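(* Let $\Pi$ be a logic program over a vocabulary $\sigma$, let $\iota\subseteq\sigma$ be a vocabulary with $hd(\Pi)\cap\iota=\emptyset$, and let $X$ be a set of atoms over $\sigma$ that is a model of the input completion $IComp(\Pi,\iota)$. Then $X$ is an input answer set of $\Pi$ relative to $\iota$ if and only if there is a level ranking of $X$ for $\Pi$ relative to $\iota$.
   Context: A logic program $\Pi$ over a vocabulary (set of atoms) $\sigma$ is a set of rules $a\leftarrow b_1,\ldots,b_\ell,\ not\ b_{\ell+1},\ldots,\ not\ b_m,\ not\ not\ b_{m+1},\ldots,\ not\ not\ b_n$ ($a\in\sigma$ or $a=\bot$, $b_i\in\sigma$), identified with the formula $B\rightarrow a$ where the body is $B=b_1\wedge\cdots\wedge b_\ell\wedge\neg b_{\ell+1}\wedge\cdots\wedge\neg b_m\wedge\neg\neg b_{m+1}\wedge\cdots\wedge\neg\neg b_n$; $B^+=\{b_1,\dots,b_\ell\}$ is its positive part and the remaining conjuncts its negative part. Sets of atoms are identified with assignments making exactly their atoms true. $hd(\Pi)$: heads of rules that are atoms; $Bodies(\Pi,a)$: bodies of rules with head $a$. The reduct $\Pi^X$ deletes each rule whose negative part $X$ does not satisfy and replaces the rest by $a\leftarrow b_1,\dots,b_\ell$; $X$ is an answer set of $\Pi$ if it is a minimal set satisfying all rules of $\Pi^X$. For $\iota\subseteq\sigma$ with $hd(\Pi)\cap\iota=\emptyset$: $X\subseteq\sigma$ is an input answer set of $\Pi$ relative to $\iota$ if $X$ is an answer set of $\Pi\cup\{a.\mid a\in X\cap\iota\}$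 (facts); $IComp(\Pi,\iota)$ is the set of formulas consisting of the rules of $\Pi$ and the implications $a\rightarrow\bigvee_{B\in Bodies(\Pi,a)}B$ for all $a\in\sigma\setminus\iota$ (empty disjunction $=\bot$); a level ranking of $X$ for $\Pi$ relative to $\iota$ is a function $lr:X\setminus\iota\to\mathbb{N}$ such that for each $a\in X\setminus\iota$ there is $B\in Bodies(\Pi,a)$ with $X$ satisfying $B$ and $lr(a)-1\geq lr(b)$ for every $b\in B^+\setminus\iota$. *)

theory Defs
  imports Main
begin

text \<open>Propositional formulas. The disjunction ranges over a possibly infinite indexed family, because
  a program is not required to be finite and so may have infinitely many rules with one head.\<close>

datatype ('a, 'i) formula =
    Bot
  | Atom 'a
  | Neg "('a, 'i) formula"
  | Conj "('a, 'i) formula list"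
  | Disj "'i set" "'i \<Rightarrow> ('a, 'i) formula"
  | Impl "('a, 'i) formula" "('a, 'i) formula"

primrec sat :: "'a set \<Rightarrow> ('a, 'i) formula \<Rightarrow> bool" where
  "sat X Bot \<longleftrightarrow> False"
| "sat X (Atom a) \<longleftrightarrow> a \<in> X"
| "sat X (Neg F) \<longleftrightarrow> \<not> sat X F"
| "sat X (Conj Fs) \<longleftrightarrow> (\<forall>p \<in> set (map (sat X) Fs). p)"
| "sat X (Disj I F) \<longleftrightarrow> (\<exists>i \<in> I. sat X (F i))"
| "sat X (Impl F G) \<longleftrightarrow> (sat X F \<longrightarrow> sat X G)"

definition is_model :: "'a set \<Rightarrow> ('a, 'i) formula set \<Rightarrow> bool" where
  "is_model X \<Gamma> \<longleftrightarrow> (\<forall>F \<in> \<Gamma>. sat X F)"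

text \<open>A body lists the atoms \<open>b\<close> of its conjuncts \<open>b\<close>, \<open>not b\<close> and \<open>not not b\<close> in three separate
  components; the head \<open>None\<close> stands for \<open>\<bottom>\<close>.\<close>

datatype 'a body = Body (pos: "'a list") (neg: "'a list") (dneg: "'a list")

datatype 'a lp_rule = Rule (head: "'a option") (body: "'a body")

type_synonym 'a program = "'a lp_rule set"

definition atoms_of_rule :: "'a lp_rule \<Rightarrow> 'a set" where
  "atoms_of_rule r =
     set_option (head r) \<union> set (pos (body r)) \<union> set (neg (body r)) \<union> set (dneg (body r))"

definition program_over :: "'a set \<Rightarrow> 'a program \<Rightarrow> bool" where
  "program_over \<sigma> \<Pi> \<longleftrightarrow> (\<forall>r \<in> \<Pi>. atoms_of_rule r \<subseteq> \<sigma>)"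

definition neg_conjuncts :: "'a body \<Rightarrow> ('a, 'a body) formula list" where
  "neg_conjuncts B = map (\<lambda>b. Neg (Atom b)) (neg B) @ map (\<lambda>b. Neg (Neg (Atom b))) (dneg B)"

definition body_formula :: "'a body \<Rightarrow> ('a, 'a body) formula" where
  "body_formula B = Conj (map Atom (pos B) @ neg_conjuncts B)"

definition head_formula :: "'a option \<Rightarrow> ('a, 'a body) formula" where
  "head_formula h = (case h of None \<Rightarrow> Bot | Some a \<Rightarrow> Atom a)"

definition rule_formula :: "'a lp_rule \<Rightarrow> ('a, 'a body) formula" where
  "rule_formula r = Impl (body_formula (body r)) (head_formula (head r))"

definition hd_atoms :: "'a program \<Rightarrow> 'a set" where
  "hd_atoms \<Pi> = {a. \<exists>r \<in> \<Pi>. head r = Some a}"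

definition Bodies :: "'a program \<Rightarrow> 'a \<Rightarrow> 'a body set" where
  "Bodies \<Pi> a = {body r | r. r \<in> \<Pi> \<and> head r = Some a}"

definition reduct :: "'a program \<Rightarrow> 'a set \<Rightarrow> 'a program" where
  "reduct \<Pi> X =
     {Rule (head r) (Body (pos (body r)) [] []) | r. r \<in> \<Pi> \<and> sat X (Conj (neg_conjuncts (body r)))}"

definition answer_set :: "'a program \<Rightarrow> 'a set \<Rightarrow> bool" where
  "answer_set \<Pi> X \<longleftrightarrow>
     is_model X (rule_formula ` reduct \<Pi> X) \<and>
     \<not> (\<exists>Y. Y \<subset> X \<and> is_model Y (rule_formula ` reduct \<Pi> X))"

definition facts :: "'a set \<Rightarrow> 'a program" where
  "facts A = {Rule (Some a) (Body [] [] []) | a. a \<in> A}"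

definition input_answer_set :: "'a set \<Rightarrow> 'a program \<Rightarrow> 'a set \<Rightarrow> 'a set \<Rightarrow> bool" where
  "input_answer_set \<sigma> \<Pi> \<iota> X \<longleftrightarrow> X \<subseteq> \<sigma> \<and> answer_set (\<Pi> \<union> facts (X \<inter> \<iota>)) X"

definition IComp :: "'a set \<Rightarrow> 'a program \<Rightarrow> 'a set \<Rightarrow> ('a, 'a body) formula set" where
  "IComp \<sigma> \<Pi> \<iota> =
     rule_formula ` \<Pi> \<union> {Impl (Atom a) (Disj (Bodies \<Pi> a) body_formula) | a. a \<in> \<sigma> - \<iota>}"

text \<open>A ranking \<open>X - \<iota> \<rightarrow> \<nat>\<close> is given by a total function whose values outside \<open>X - \<iota>\<close> are never
  inspected: if \<open>X\<close> satisfies \<open>B\<close>, then \<open>set (pos B) \<subseteq> X\<close>. The subtraction is taken in the integers, so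
  that \<open>lr a = 0\<close> does not permit a positive body atom outside \<open>\<iota>\<close>.\<close>

definition level_ranking :: "'a program \<Rightarrow> 'a set \<Rightarrow> 'a set \<Rightarrow> ('a \<Rightarrow> nat) \<Rightarrow> bool" where
  "level_ranking \<Pi> \<iota> X lr \<longleftrightarrow>
     (\<forall>a \<in> X - \<iota>. \<exists>B \<in> Bodies \<Pi> a.
        sat X (body_formula B) \<and> (\<forall>b \<in> set (pos B) - \<iota>. int (lr a) - 1 \<ge> int (lr b)))"

end

theory Submission
  imports Defs
begin

text \<open>The reduct of \<open>\<Pi>\<close> with the input facts is a positive program, and its least model inside \<open>X\<close> is
  the union of the stages of the immediate consequence operator; finiteness of positive bodies makes
  \<open>\<omega>\<close> stages suffice even if \<open>\<Pi>\<close> is infinite. If \<open>X\<close> is an answer set, every atom of \<open>X - \<iota>\<close> enters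
  at some stage, and the first such stage is a level ranking. Conversely, induction on the level of
  an atom puts all of \<open>X\<close> into every model of the reduct.\<close>

lemma sat_body_formula:
  "sat Y (body_formula B) \<longleftrightarrow> set (pos B) \<subseteq> Y \<and> sat Y (Conj (neg_conjuncts B))"
  by (auto simp: body_formula_def)

lemma sat_head_Some [simp]: "sat Y (head_formula (Some a)) \<longleftrightarrow> a \<in> Y"
  by (simp add: head_formula_def)

lemma sat_reduct_rule:
  "sat Y (rule_formula (Rule h (Body P [] []))) \<longleftrightarrow> (set P \<subseteq> Y \<longrightarrow> sat Y (head_formula h))"
  by (auto simp: rule_formula_def sat_body_formula neg_conjuncts_def)

lemma is_model_reduct:
  "is_model Y (rule_formula ` reduct \<Pi> X) \<longleftrightarrow>
     (\<forall>r \<in> \<Pi>. sat X (Conj (neg_conjuncts (body r))) \<longrightarrow> set (pos (body r)) \<subseteq> Y \<longrightarrow>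
        sat Y (head_formula (head r)))"
  unfolding is_model_def reduct_def ball_simps
  by (force simp: sat_reduct_rule simp del: sat.simps)

text \<open>Facts have empty bodies, so they survive every reduct unchanged and only force
  \<open>A\<close> into the model.\<close>

lemma is_model_reduct_facts:
  "is_model Y (rule_formula ` reduct (\<Pi> \<union> facts A) X) \<longleftrightarrow>
     is_model Y (rule_formula ` reduct \<Pi> X) \<and> A \<subseteq> Y"
  by (fastforce simp: is_model_reduct facts_def ball_Un neg_conjuncts_def)

text \<open>A rule deleted from the reduct has a body false in \<open>X\<close>, so \<open>X\<close>
  satisfies it anyway; for the other rules only the positive part of the body matters.\<close>

lemma is_model_reduct_self:
  "is_model X (rule_formula ` reduct \<Pi> X) \<longleftrightarrow> is_model X (rule_formula ` \<Pi>)"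
  unfolding is_model_reduct by (auto simp: is_model_def rule_formula_def sat_body_formula)

text \<open>The whole body, not just its negative part, is evaluated in \<open>X\<close>: this is
  what a level ranking asks of a supporting body. It also makes it harmless to grant all of
  \<open>\<iota>\<close> instead of \<open>X \<inter> \<iota>\<close>.\<close>

primrec stage :: "'a program \<Rightarrow> 'a set \<Rightarrow> 'a set \<Rightarrow> nat \<Rightarrow> 'a set" where
  "stage \<Pi> \<iota> X 0 = {}"
| "stage \<Pi> \<iota> X (Suc n) =
     {a. \<exists>B \<in> Bodies \<Pi> a. sat X (body_formula B) \<and> set (pos B) \<subseteq> \<iota> \<union> stage \<Pi> \<iota> X n}"

lemma stage_mono: "m \<le> n \<Longrightarrow> stage \<Pi> \<iota> X m \<subseteq> stage \<Pi> \<iota> X n"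
proof (rule lift_Suc_mono_le)
  show "stage \<Pi> \<iota> X k \<subseteq> stage \<Pi> \<iota> X (Suc k)" for k
    by (induction k) (simp, fastforce)
qed

lemma stage_subset:
  assumes "is_model X (rule_formula ` \<Pi>)"
  shows "stage \<Pi> \<iota> X n \<subseteq> X"
proof (cases n)
  case (Suc m)
  show ?thesis
  proof
    fix a
    assume "a \<in> stage \<Pi> \<iota> X n"
    then obtain r where "r \<in> \<Pi>" "head r = Some a" "sat X (body_formula (body r))"
      by (auto simp: Suc Bodies_def)
    with assms show "a \<in> X"
      by (auto simp: is_model_def rule_formula_def)
  qed
qed simp

text \<open>The stages form a chain, so the maximum of finitely many entry stages serves all of
  \<open>S\<close>.\<close>

lemma finite_subset_stage:
  assumes "finite S" "S \<subseteq> \<iota> \<union> (\<Union>n. stage \<Pi> \<iota> X n)"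
  obtains n where "S \<subseteq> \<iota> \<union> stage \<Pi> \<iota> X n"
proof -
  have "\<exists>n. S \<subseteq> \<iota> \<union> stage \<Pi> \<iota> X n"
    using assms
  proof induction
    case (insert x S)
    then obtain m n where "S \<subseteq> \<iota> \<union> stage \<Pi> \<iota> X m" "x \<in> \<iota> \<union> stage \<Pi> \<iota> X n"
      by auto
    moreover have "stage \<Pi> \<iota> X m \<subseteq> stage \<Pi> \<iota> X (max m n)" "stage \<Pi> \<iota> X n \<subseteq> stage \<Pi> \<iota> X (max m n)"
      by (simp_all add: stage_mono)
    ultimately have "insert x S \<subseteq> \<iota> \<union> stage \<Pi> \<iota> X (max m n)"
      by blast
    then show ?case ..
  qed simp
  then show ?thesis
    using that by blast
qed

lemma is_model_stages:
  assumes "is_model X (rule_formula ` \<Pi>)"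
  shows "is_model (X \<inter> \<iota> \<union> (\<Union>n. stage \<Pi> \<iota> X n)) (rule_formula ` reduct \<Pi> X)"
    (is "is_model ?Y _")
  unfolding is_model_reduct
proof (intro ballI impI)
  fix r
  assume r: "r \<in> \<Pi>" and neg: "sat X (Conj (neg_conjuncts (body r)))"
    and pos: "set (pos (body r)) \<subseteq> ?Y"
  \<comment> \<open>Positive atoms in \<open>?Y\<close> are thus true in \<open>X\<close>, which
    gives the truth of the full body in \<open>X\<close> that \<open>stage\<close> requires.\<close>
  have "?Y \<subseteq> X"
    using stage_subset[OF assms] by blast
  with neg pos have B: "sat X (body_formula (body r))"
    unfolding sat_body_formula by blast
  show "sat ?Y (head_formula (head r))"
  proof (cases "head r")
    \<comment> \<open>This case is void: \<open>X\<close> would violate a constraint of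
      \<open>\<Pi>\<close>.\<close>
    case None
    with r B assms show ?thesis
      by (auto simp: is_model_def rule_formula_def head_formula_def)
  next
    case (Some a)
    obtain n where n: "set (pos (body r)) \<subseteq> \<iota> \<union> stage \<Pi> \<iota> X n"
      by (rule finite_subset_stage[of "set (pos (body r))" \<iota> \<Pi> X]) (use pos in auto)
    have "body r \<in> Bodies \<Pi> a"
      using r Some by (auto simp: Bodies_def)
    with B n have "a \<in> stage \<Pi> \<iota> X (Suc n)"
      by auto
    then show ?thesis
      unfolding Some sat_head_Some by blast
  qed
qed

lemma level_ranking_stage:
  assumes "X - \<iota> \<subseteq> (\<Union>n. stage \<Pi> \<iota> X n)"
  shows "level_ranking \<Pi> \<iota> X (\<lambda>a. LEAST n. a \<in> stage \<Pi> \<iota> X n)"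
  unfolding level_ranking_def
proof
  fix a
  assume "a \<in> X - \<iota>"
  let ?lr = "\<lambda>a. LEAST n. a \<in> stage \<Pi> \<iota> X n"
  have lr: "a \<in> stage \<Pi> \<iota> X (?lr a)"
    using \<open>a \<in> X - \<iota>\<close> assms by (auto intro: LeastI)
  \<comment> \<open>Stage 0 is empty, so the first stage containing \<open>a\<close> is a successor;
    the body that admits \<open>a\<close> has its atoms outside \<open>\<iota>\<close> one stage
    earlier.\<close>
  then obtain m where m: "?lr a = Suc m"
    by (cases "?lr a") auto
  with lr obtain B where B: "B \<in> Bodies \<Pi> a" "sat X (body_formula B)"
      "set (pos B) \<subseteq> \<iota> \<union> stage \<Pi> \<iota> X m"
    by auto
  have "?lr b \<le> m" if "b \<in> set (pos B) - \<iota>" for b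
    using that B(3) by (blast intro: Least_le)
  with B m show "\<exists>B \<in> Bodies \<Pi> a. sat X (body_formula B) \<and>
      (\<forall>b \<in> set (pos B) - \<iota>. int (?lr a) - 1 \<ge> int (?lr b))"
    by auto
qed

text \<open>The body supporting \<open>a\<close> is true in \<open>X\<close>, so its rule survives
  in the reduct; its positive atoms lie in \<open>X \<inter> \<iota>\<close> or have smaller rank,
  hence lie in \<open>Y\<close>.\<close>

lemma level_ranking_subset:
  assumes lr: "level_ranking \<Pi> \<iota> X lr"
    and Y: "is_model Y (rule_formula ` reduct \<Pi> X)" "X \<inter> \<iota> \<subseteq> Y"
  shows "X \<subseteq> Y"
proof
  fix a
  assume "a \<in> X"
  then show "a \<in> Y"
  proof (induction "lr a" arbitrary: a rule: less_induct)
    case less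
    show ?case
    proof (cases "a \<in> \<iota>")
      case True
      with less.prems Y(2) show ?thesis by blast
    next
      case False
      with lr less.prems obtain r where r: "r \<in> \<Pi>" "head r = Some a"
          "sat X (body_formula (body r))"
          "\<forall>b \<in> set (pos (body r)) - \<iota>. int (lr a) - 1 \<ge> int (lr b)"
        unfolding level_ranking_def Bodies_def by blast
      have "b \<in> Y" if b: "b \<in> set (pos (body r))" for b
      proof (cases "b \<in> \<iota>")
        case True
        with b r(3) Y(2) show ?thesis
          unfolding sat_body_formula by blast
      next
        case False
        \<comment> \<open>Over the integers this means \<open>lr b < lr a\<close>, also when
          \<open>lr a = 0\<close>, so the induction hypothesis applies.\<close>
        with b r(4) have "int (lr b) \<le> int (lr a) - 1" by blast
        moreover have "b \<in> X"
          using b r(3) unfolding sat_body_formula by blast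
        ultimately show ?thesis
          using less.hyps by simp
      qed
      then have "sat Y (head_formula (head r))"
        using r(1,3) Y(1) unfolding is_model_reduct sat_body_formula by blast
      then show ?thesis
        by (simp add: r(2))
    qed
  qed
qed

theorem theorem8:
  fixes \<sigma> \<iota> X :: "'a set" and \<Pi> :: "'a program"
  assumes "program_over \<sigma> \<Pi>"
    and "\<iota> \<subseteq> \<sigma>"
    and "hd_atoms \<Pi> \<inter> \<iota> = {}"
    and "X \<subseteq> \<sigma>"
    and "is_model X (IComp \<sigma> \<Pi> \<iota>)"
  shows "input_answer_set \<sigma> \<Pi> \<iota> X \<longleftrightarrow> (\<exists>lr. level_ranking \<Pi> \<iota> X lr)"
proof -
  have X: "is_model X (rule_formula ` \<Pi>)"
    using assms(5) by (simp add: IComp_def is_model_def)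
  show ?thesis
  proof
    assume "input_answer_set \<sigma> \<Pi> \<iota> X"
    then have min: "\<not> Y \<subset> X"
      if "is_model Y (rule_formula ` reduct \<Pi> X)" "X \<inter> \<iota> \<subseteq> Y" for Y
      using that unfolding input_answer_set_def answer_set_def is_model_reduct_facts by blast
    \<comment> \<open>This model of the reduct lies inside \<open>X\<close>, so minimality makes it
      all of \<open>X\<close>.\<close>
    have "\<not> X \<inter> \<iota> \<union> (\<Union>n. stage \<Pi> \<iota> X n) \<subset> X"
      by (rule min) (use is_model_stages[OF X] in auto)
    then have "X - \<iota> \<subseteq> (\<Union>n. stage \<Pi> \<iota> X n)"
      using stage_subset[OF X] by blast
    then show "\<exists>lr. level_ranking \<Pi> \<iota> X lr"
      using level_ranking_stage by blast
  next
    assume "\<exists>lr. level_ranking \<Pi> \<iota> X lr"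
    then show "input_answer_set \<sigma> \<Pi> \<iota> X"
      using level_ranking_subset iffD2[OF is_model_reduct_self X] \<open>X \<subseteq> \<sigma>\<close>
      unfolding input_answer_set_def answer_set_def is_model_reduct_facts
      by blast
  qed
qed

end
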